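(* Let $S\subset\mathbb{R}^2$ be a compact set such that $\partial S$ is path-connected and $S=\overline{\mathrm{int}(S)}$. Then $S$ is biconvex with respect to $b_1,b_2$ if and only if there exists $\xi\in\mathbb{R}^2$ with $\|\xi\|=1$ such that for all $y\in S^c$ there exist $i\in\{0,1,2,3\}$ and $z\in\mathbb{R}^2$ such that $y\in C_{\pi/2,R^i(\xi)}(z)\subset S^c$.
   Context: $\mathbb{R}^2$ carries the Euclidean norm $\|\cdot\|$ and inner product $\langle\cdot,\cdot\rangle$; $\partial S$, $\mathrm{int}(S)$, $\overline{S}$ and $S^c$ denote boundary, interior, closure and complement of $S$. Biconvexity: $b_1,b_2$ denote two orthonormal vectors of $\mathbb{R}^2$. A set $S\subset\mathbb{R}^2$ is biconvex with respect to $b_1,b_2$ if for all $\alpha,\beta\in\mathbb{R}$ the sets $\{\alpha b_1+tb_2:t\in\mathbb{R}\}\cap S$ and $\{tb_1+\beta b_2:t\in\mathbb{R}\}\cap S$ are convex (possibly empty). Rotations and cones: $R$ is the counter-clockwise rotation of angle $\pi/2$ about the origin, $R^0(\xi)=\xi$ and $R^i(\xi)=R(R^{i-1}(\xi))$ for $i=1,2,3$. For a unit vector $v$ and $x\in\mathbb{R}^2$, $C_{\pi/2,v}(x)$ is the open infinite cone with vertex $x$, axis direction $v$ and opening angle $\pi/2$: $$C_{\pi/2,v}(x)=\Big\{w\in\mathbb{R}^2,\ w\neq x:\ \Big\langle v,\frac{w-x}{\|w-x\|}\Big\rangle>\cos(\pi/4)\Big\}.$$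
   Formalization: "Biconvex with respect to b1,b2" is read as biconvex with respect to some orthonormal pair b1,b2; for a fixed pair the "if" direction fails (L-shape [0,2]^2 \ (1,2]^2 with b1,b2 at 45 degrees). *)

theory Defs
  imports "HOL-Analysis.Analysis"
begin

definition biconvex :: "real^2 \<Rightarrow> real^2 \<Rightarrow> (real^2) set \<Rightarrow> bool" where
  "biconvex b1 b2 S \<longleftrightarrow>
     (\<forall>\<alpha>. convex ({\<alpha> *\<^sub>R b1 + t *\<^sub>R b2 |t. t \<in> UNIV} \<inter> S)) \<and>
     (\<forall>\<beta>. convex ({t *\<^sub>R b1 + \<beta> *\<^sub>R b2 |t. t \<in> UNIV} \<inter> S))"

definition orthonormal_pair :: "real^2 \<Rightarrow> real^2 \<Rightarrow> bool" where
  "orthonormal_pair b1 b2 \<longleftrightarrow> norm b1 = 1 \<and> norm b2 = 1 \<and> inner b1 b2 = 0"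

text \<open>Counter-clockwise rotation by \<open>pi / 2\<close> about the origin.\<close>

definition rot90 :: "real^2 \<Rightarrow> real^2" where
  "rot90 x = vector [- (x $ 2), x $ 1]"

text \<open>Open infinite cone with vertex \<open>x\<close> and axis direction \<open>v\<close> (a unit vector); the
  opening angle is \<open>pi / 2\<close>, hence the half-angle \<open>pi / 4\<close>.\<close>

definition right_cone :: "real^2 \<Rightarrow> real^2 \<Rightarrow> (real^2) set" where
  "right_cone v x = {w. w \<noteq> x \<and> inner v ((w - x) /\<^sub>R norm (w - x)) > cos (pi / 4)}"

end

theory Submission
  imports Defs
begin

text \<open>Writing \<open>\<xi> = (u + v) / sqrt 2\<close> with \<open>u, v\<close> orthonormal, the four cones are the open
  quadrants with respect to \<open>u, v\<close>. If \<open>y \<notin> S\<close> lies on an axis-parallel segment with endpoints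
  in \<open>S\<close>, each open quadrant containing \<open>y\<close> contains one of the endpoints, which gives one
  implication. Conversely, for \<open>y \<notin> S\<close> biconvexity makes \<open>S\<close> miss one of the two horizontal
  and one of the two vertical closed half-axes emanating from \<open>y\<close>. They bound a closed quadrant,
  and as \<open>frontier S\<close> is connected, \<open>S\<close> cannot meet both this quadrant and the opposite one.
  A closed quadrant missing the compact set \<open>S\<close> can be enlarged to an open one that
  contains \<open>y\<close>.\<close>

section \<open>Coordinates in an orthonormal basis of the plane\<close>

text \<open>Orthogonal unit vectors are independent, so two of them span the plane by dimension;
  inner products then recover the coefficients.\<close>

lemma orthonormal_pair_expansion:
  assumes "orthonormal_pair u v"
  shows "x = (u \<bullet> x) *\<^sub>R u + (v \<bullet> x) *\<^sub>R v"
proof -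
  have o: "norm u = 1" "norm v = 1" "u \<bullet> v = 0"
    using assms by (auto simp: orthonormal_pair_def)
  then have "u \<noteq> v" by auto
  have "independent {u, v}"
    using o by (intro pairwise_orthogonal_independent)
      (auto simp: pairwise_def orthogonal_def inner_commute)
  then have "(UNIV :: (real^2) set) \<subseteq> span {u, v}"
    using \<open>u \<noteq> v\<close> by (intro card_ge_dim_independent) auto
  then obtain a b where "x = a *\<^sub>R u + b *\<^sub>R v"
    by (force simp: span_insert span_singleton algebra_simps)
  then show ?thesis
    using o by (simp add: inner_add_right dot_square_norm inner_commute)
qed

lemma orthonormal_pair_inner_inverse:
  assumes "orthonormal_pair u v"
  shows "u \<bullet> (a *\<^sub>R u + b *\<^sub>R v) = a" "v \<bullet> (a *\<^sub>R u + b *\<^sub>R v) = b"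
  using assms by (auto simp: orthonormal_pair_def inner_add_right dot_square_norm inner_commute)

lemma orthonormal_pair_eqI:
  assumes "orthonormal_pair u v" "u \<bullet> x = u \<bullet> y" "v \<bullet> x = v \<bullet> y"
  shows "x = y"
  using orthonormal_pair_expansion[OF assms(1), of x]
    orthonormal_pair_expansion[OF assms(1), of y] assms(2,3) by simp

lemma orthonormal_pair_commute: "orthonormal_pair u v \<longleftrightarrow> orthonormal_pair v u"
  by (auto simp: orthonormal_pair_def inner_commute)

lemma orthonormal_pair_uminus:
  "orthonormal_pair (- u) v \<longleftrightarrow> orthonormal_pair u v"
  "orthonormal_pair u (- v) \<longleftrightarrow> orthonormal_pair u v"
  by (auto simp: orthonormal_pair_def)

section \<open>Biconvexity in coordinates\<close>

lemma orthonormal_pair_line: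
  assumes "orthonormal_pair u v"
  shows "{\<alpha> *\<^sub>R u + t *\<^sub>R v |t. t \<in> UNIV} = {w. u \<bullet> w = \<alpha>}"
  using orthonormal_pair_expansion[OF assms]
  by (auto simp: orthonormal_pair_inner_inverse[OF assms])

text \<open>On a line with constant \<open>u\<close>-coordinate the \<open>v\<close>-coordinate is
  an affine parameter, so lying on a segment amounts to two inequalities. This order form is what
  can be compared with quadrants.\<close>

lemma convex_lines_Int_iff:
  assumes "orthonormal_pair u v"
  shows "(\<forall>\<alpha>. convex ({w. u \<bullet> w = \<alpha>} \<inter> S)) \<longleftrightarrow>
    (\<forall>p\<in>S. \<forall>q\<in>S. \<forall>y. u \<bullet> p = u \<bullet> y \<and> u \<bullet> q = u \<bullet> y \<and> v \<bullet> p \<le> v \<bullet> y \<and> v \<bullet> y \<le> v \<bullet> q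
      \<longrightarrow> y \<in> S)" (is "?L \<longleftrightarrow> ?R")
proof
  assume L: ?L
  show ?R
  proof (intro ballI allI impI, elim conjE)
    fix p q y
    assume h: "p \<in> S" "q \<in> S" "u \<bullet> p = u \<bullet> y" "u \<bullet> q = u \<bullet> y"
      "v \<bullet> p \<le> v \<bullet> y" "v \<bullet> y \<le> v \<bullet> q"
    then have "v \<bullet> y \<in> closed_segment (v \<bullet> p) (v \<bullet> q)"
      by (simp add: closed_segment_eq_real_ivl)
    then obtain t where t: "0 \<le> t" "t \<le> 1" "v \<bullet> y = (1 - t) * (v \<bullet> p) + t * (v \<bullet> q)"
      by (auto simp: in_segment)
    have "y = (1 - t) *\<^sub>R p + t *\<^sub>R q"
      using h t by (intro orthonormal_pair_eqI[OF assms]) (auto simp: inner_add_right algebra_simps)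
    then show "y \<in> S"
      using convexD_alt[OF L[rule_format, of "u \<bullet> y"], of p q t] h t by auto
  qed
next
  assume R: ?R
  show ?L
    unfolding convex_contains_segment
  proof (intro allI ballI subsetI)
    fix \<alpha> p q y
    assume h: "p \<in> {w. u \<bullet> w = \<alpha>} \<inter> S" "q \<in> {w. u \<bullet> w = \<alpha>} \<inter> S" "y \<in> closed_segment p q"
    then obtain t where t: "0 \<le> t" "t \<le> 1" "y = (1 - t) *\<^sub>R p + t *\<^sub>R q"
      by (auto simp: in_segment)
    have uy: "u \<bullet> y = \<alpha>"
      using h t(3) by (auto simp: inner_add_right left_diff_distrib)
    have "v \<bullet> y = (1 - t) * (v \<bullet> p) + t * (v \<bullet> q)"
      using t by (simp add: inner_add_right)
    then have "v \<bullet> y \<in> closed_segment (v \<bullet> p) (v \<bullet> q)"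
      using t by (auto simp: in_segment)
    then have "v \<bullet> p \<le> v \<bullet> y \<and> v \<bullet> y \<le> v \<bullet> q \<or> v \<bullet> q \<le> v \<bullet> y \<and> v \<bullet> y \<le> v \<bullet> p"
      by (auto simp: closed_segment_eq_real_ivl split: if_splits)
    then show "y \<in> {w. u \<bullet> w = \<alpha>} \<inter> S"
      using R[rule_format, of p q y] R[rule_format, of q p y] h uy by auto
  qed
qed

lemma biconvex_iff:
  assumes "orthonormal_pair u v"
  shows "biconvex u v S \<longleftrightarrow>
    (\<forall>p\<in>S. \<forall>q\<in>S. \<forall>y. u \<bullet> p = u \<bullet> y \<and> u \<bullet> q = u \<bullet> y \<and> v \<bullet> p \<le> v \<bullet> y \<and> v \<bullet> y \<le> v \<bullet> q
      \<longrightarrow> y \<in> S) \<and>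
    (\<forall>p\<in>S. \<forall>q\<in>S. \<forall>y. v \<bullet> p = v \<bullet> y \<and> v \<bullet> q = v \<bullet> y \<and> u \<bullet> p \<le> u \<bullet> y \<and> u \<bullet> y \<le> u \<bullet> q
      \<longrightarrow> y \<in> S)"
proof -
  have assms': "orthonormal_pair v u"
    using assms orthonormal_pair_commute by blast
  have line: "{t *\<^sub>R u + \<beta> *\<^sub>R v |t. t \<in> UNIV} = {w. v \<bullet> w = \<beta>}" for \<beta>
    using orthonormal_pair_line[OF assms', of \<beta>] by (simp add: add.commute)
  show ?thesis
    unfolding biconvex_def orthonormal_pair_line[OF assms] line
      convex_lines_Int_iff[OF assms] convex_lines_Int_iff[OF assms'] ..
qed

section \<open>Quadrants and right-angled cones\<close>

text \<open>The orientation is carried by the signs of \<open>u\<close> and \<open>v\<close>: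
  passing \<open>- u\<close> or \<open>- v\<close> yields the other three quadrants at
  \<open>z\<close>.\<close>

definition open_quadrant :: "real^2 \<Rightarrow> real^2 \<Rightarrow> real^2 \<Rightarrow> (real^2) set" where
  "open_quadrant u v z = {w. u \<bullet> z < u \<bullet> w \<and> v \<bullet> z < v \<bullet> w}"

definition closed_quadrant :: "real^2 \<Rightarrow> real^2 \<Rightarrow> real^2 \<Rightarrow> (real^2) set" where
  "closed_quadrant u v z = {w. u \<bullet> z \<le> u \<bullet> w \<and> v \<bullet> z \<le> v \<bullet> w}"

lemma closed_closed_quadrant: "closed (closed_quadrant u v z)"
  unfolding closed_quadrant_def Collect_conj_eq
  by (intro closed_Int closed_Collect_le continuous_intros)

lemma open_open_quadrant: "open (open_quadrant u v z)"
  unfolding open_quadrant_def Collect_conj_eq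
  by (intro open_Int open_Collect_less continuous_intros)

text \<open>The cone condition in coordinates. The root dominates both absolute values, so if
  \<open>a + b\<close> exceeds it, each summand is positive; conversely compare squares, where
  \<open>2 * a * b > 0\<close> is the excess.\<close>

lemma sqrt_sum_squares_less_sum_iff:
  fixes a b :: real
  shows "sqrt (a\<^sup>2 + b\<^sup>2) < a + b \<longleftrightarrow> 0 < a \<and> 0 < b"
proof
  assume h: "sqrt (a\<^sup>2 + b\<^sup>2) < a + b"
  have "\<bar>a\<bar> \<le> sqrt (a\<^sup>2 + b\<^sup>2)" "\<bar>b\<bar> \<le> sqrt (a\<^sup>2 + b\<^sup>2)"
    by (auto intro: real_le_rsqrt)
  with h show "0 < a \<and> 0 < b" by linarith
next
  assume "0 < a \<and> 0 < b"
  then show "sqrt (a\<^sup>2 + b\<^sup>2) < a + b"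
    by (intro real_less_lsqrt) (auto simp: power2_sum)
qed

text \<open>If \<open>w - z\<close> has coordinates \<open>a\<close> and \<open>b\<close>, its inner
  product with the diagonal is \<open>(a + b) / sqrt 2\<close>. As
  \<open>cos (pi / 4) = 1 / sqrt 2\<close>, the angle condition says that the norm of
  \<open>w - z\<close> is less than \<open>a + b\<close>.\<close>

lemma right_cone_eq_open_quadrant:
  assumes "orthonormal_pair u v"
  shows "right_cone ((u + v) /\<^sub>R sqrt 2) z = open_quadrant u v z"
proof -
  have "w \<in> right_cone ((u + v) /\<^sub>R sqrt 2) z \<longleftrightarrow> w \<in> open_quadrant u v z" for w
  proof (cases "w = z")
    case True
    then show ?thesis by (simp add: right_cone_def open_quadrant_def)
  next
    case False
    define d a b where "d = w - z" and "a = u \<bullet> d" and "b = v \<bullet> d"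
    have "d \<bullet> d = a\<^sup>2 + b\<^sup>2"
      using arg_cong[OF orthonormal_pair_expansion[OF assms, of d], of "inner d"]
      by (simp add: inner_add_right a_def b_def power2_eq_square inner_commute)
    then have nd: "norm d = sqrt (a\<^sup>2 + b\<^sup>2)"
      by (simp add: norm_eq_sqrt_inner)
    have pos: "norm d > 0" using False by (simp add: d_def)
    have "w \<in> right_cone ((u + v) /\<^sub>R sqrt 2) z \<longleftrightarrow>
        cos (pi / 4) < ((u + v) /\<^sub>R sqrt 2) \<bullet> (d /\<^sub>R norm d)"
      using False by (simp add: right_cone_def d_def)
    also have "((u + v) /\<^sub>R sqrt 2) \<bullet> (d /\<^sub>R norm d) = (a + b) / norm d / sqrt 2"
      by (simp add: inner_add_left a_def b_def field_simps)
    also have "cos (pi / 4) = 1 / sqrt 2"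
      by (simp add: cos_45 real_div_sqrt divide_simps)
    also have "1 / sqrt 2 < (a + b) / norm d / sqrt 2 \<longleftrightarrow> norm d < a + b"
      using pos by (simp add: divide_simps)
    also have "\<dots> \<longleftrightarrow> 0 < a \<and> 0 < b"
      unfolding nd by (rule sqrt_sum_squares_less_sum_iff)
    finally show ?thesis
      by (simp add: open_quadrant_def a_def b_def d_def inner_diff_right)
  qed
  then show ?thesis by blast
qed

section \<open>Quarter turns and the four diagonals\<close>

lemma rot90_add: "rot90 (x + y) = rot90 x + rot90 y"
  and rot90_scaleR: "rot90 (c *\<^sub>R x) = c *\<^sub>R rot90 x"
  and rot90_minus: "rot90 (- x) = - rot90 x"
  and rot90_rot90: "rot90 (rot90 x) = - x"
  and inner_rot90_self: "x \<bullet> rot90 x = 0"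
  and norm_rot90: "norm (rot90 x) = norm x"
  by (auto simp: rot90_def vec_eq_iff forall_2 inner_vec_def sum_2 norm_eq_sqrt_inner)

lemma orthonormal_pair_rot90:
  assumes "norm u = 1" shows "orthonormal_pair u (rot90 u)"
  using assms by (simp add: orthonormal_pair_def norm_rot90 inner_rot90_self)

lemma orthonormal_pair_cases:
  assumes "orthonormal_pair u v"
  shows "v = rot90 u \<or> v = - rot90 u"
proof -
  have o: "norm u = 1" "norm v = 1" "u \<bullet> v = 0"
    using assms by (auto simp: orthonormal_pair_def)
  have "v = (rot90 u \<bullet> v) *\<^sub>R rot90 u"
    using orthonormal_pair_expansion[OF orthonormal_pair_rot90[OF o(1)], of v] o by simp
  moreover from this have "\<bar>rot90 u \<bullet> v\<bar> = 1"
    using o by (metis mult_cancel_left2 mult.right_neutral norm_rot90 norm_scaleR)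
  ultimately show ?thesis
    by (metis abs_eq_iff abs_1 scaleR_minus1_left scaleR_one)
qed

text \<open>A quarter turn permutes the four diagonals cyclically, in a direction that depends on
  the orientation of \<open>u, v\<close>. The predicate \<open>P\<close> takes the whole family of
  translates, so that the vertex can be quantified inside it.\<close>

lemma ex_cone_iff_ex_quadrant:
  assumes "orthonormal_pair u v"
  shows "(\<exists>i\<in>{0, 1, 2, 3}. P (right_cone ((rot90 ^^ i) ((u + v) /\<^sub>R sqrt 2)))) \<longleftrightarrow>
    (\<exists>u'\<in>{u, - u}. \<exists>v'\<in>{v, - v}. P (open_quadrant u' v'))"
proof -
  have "right_cone ((u' + v') /\<^sub>R sqrt 2) = open_quadrant u' v'"
    if "u' \<in> {u, - u}" "v' \<in> {v, - v}" for u' v'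
    using that assms by (intro ext right_cone_eq_open_quadrant) (auto simp: orthonormal_pair_uminus)
  from this[of u v] this[of "- u" v] this[of u "- v"] this[of "- u" "- v"]
  \<comment> \<open>The sums are written exactly as rotating \<open>u + v\<close> produces them, for
    both orientations, so that they can serve as rewrite rules.\<close>
  have cones: "right_cone ((u + v) /\<^sub>R sqrt 2) = open_quadrant u v"
      "right_cone ((v + - u) /\<^sub>R sqrt 2) = open_quadrant (- u) v"
      "right_cone ((- v + u) /\<^sub>R sqrt 2) = open_quadrant u (- v)"
      "right_cone (- ((u + v) /\<^sub>R sqrt 2)) = open_quadrant (- u) (- v)"
      "right_cone (- ((v + - u) /\<^sub>R sqrt 2)) = open_quadrant u (- v)"
      "right_cone (- ((- v + u) /\<^sub>R sqrt 2)) = open_quadrant (- u) v"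
    by (simp_all add: algebra_simps)
  have pow: "(rot90 ^^ 0) x = x" "(rot90 ^^ 1) x = rot90 x" "(rot90 ^^ 2) x = - x"
      "(rot90 ^^ 3) x = - rot90 x" for x
    by (simp_all add: numeral_eq_Suc rot90_rot90 rot90_minus)
  have "rot90 u = v \<and> rot90 v = - u \<or> rot90 u = - v \<and> rot90 v = u"
    using orthonormal_pair_cases[OF assms] by (auto simp: rot90_minus rot90_rot90)
  then show ?thesis
  proof (elim disjE conjE)
    assume "rot90 u = v" "rot90 v = - u"
    then show ?thesis
      by (simp only: bex_simps pow rot90_add rot90_scaleR cones) blast
  next
    assume "rot90 u = - v" "rot90 v = u"
    then show ?thesis
      by (simp only: bex_simps pow rot90_add rot90_scaleR cones) blast
  qed
qed

section \<open>Quadrants missed by a compact set with connected frontier\<close>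

text \<open>The ray is connected, starts in \<open>S\<close> and leaves it by boundedness.\<close>

lemma compact_ray_meets_frontier:
  fixes S :: "'a::real_normed_vector set"
  assumes "compact S" "p \<in> S" "d \<noteq> 0"
  obtains t where "t \<ge> 0" "p + t *\<^sub>R d \<in> frontier S"
proof -
  let ?R = "(\<lambda>t. p + t *\<^sub>R d) ` {0..}"
  have "connected ?R"
    by (intro connected_continuous_image continuous_intros convex_connected convex_real_interval)
  moreover have "?R \<inter> S \<noteq> {}"
    using assms(2) by (force intro: image_eqI[of _ _ 0])
  moreover have "?R - S \<noteq> {}"
  proof -
    obtain B where B: "\<And>x. x \<in> S \<Longrightarrow> norm x \<le> B"
      using compact_imp_bounded[OF assms(1)] by (auto simp: bounded_iff)
    \<comment> \<open>Chosen so that, after losing at most \<open>norm p\<close> in the triangle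
      inequality, the norm still exceeds \<open>B\<close>.\<close>
    define t where "t = (\<bar>B\<bar> + norm p + 1) / norm d"
    have "t \<ge> 0" by (simp add: t_def)
    have "norm (t *\<^sub>R d) = \<bar>B\<bar> + norm p + 1"
      using assms(3) by (simp add: t_def)
    moreover have "norm (t *\<^sub>R d) \<le> norm (p + t *\<^sub>R d) + norm p"
      using norm_triangle_ineq4[of "p + t *\<^sub>R d" p] by simp
    ultimately have "norm (p + t *\<^sub>R d) > B" by linarith
    then have "p + t *\<^sub>R d \<notin> S" using B by fastforce
    then show ?thesis using \<open>t \<ge> 0\<close> by auto
  qed
  ultimately have "?R \<inter> frontier S \<noteq> {}"
    by (rule connected_Int_frontier)
  then show ?thesis using that by auto
qed

text \<open>From a point of \<open>S\<close> in the quadrant, the ray in direction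
  \<open>u + v\<close> stays in the quadrant, since both coordinates increase along it.\<close>

lemma compact_meets_closed_quadrant_imp_frontier:
  assumes "compact S" "orthonormal_pair u v" "S \<inter> closed_quadrant u v y \<noteq> {}"
  shows "frontier S \<inter> closed_quadrant u v y \<noteq> {}"
proof -
  have o: "u \<bullet> (u + v) = 1" "v \<bullet> (u + v) = 1"
    using orthonormal_pair_inner_inverse[OF assms(2), of 1 1] by auto
  then have "u + v \<noteq> 0" by force
  moreover obtain p where "p \<in> S" and p: "p \<in> closed_quadrant u v y"
    using assms(3) by blast
  ultimately obtain t where "t \<ge> 0" "p + t *\<^sub>R (u + v) \<in> frontier S"
    using compact_ray_meets_frontier[OF assms(1)] by blast
  moreover have "p + t *\<^sub>R (u + v) \<in> closed_quadrant u v y"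
    using p o \<open>t \<ge> 0\<close> unfolding closed_quadrant_def
    by (simp add: inner_add_right[of _ p])
  ultimately show ?thesis by blast
qed

text \<open>The last two hypotheses say that \<open>S\<close> misses the closed half-axes bounding
  the quadrant. Hence the open quadrant and the complement of the closed one would separate the
  frontier if \<open>S\<close> met both opposite quadrants.\<close>

lemma misses_quadrant_or_opposite:
  assumes "compact S" "connected (frontier S)" "orthonormal_pair u v"
    and "\<And>w. w \<in> S \<Longrightarrow> v \<bullet> w = v \<bullet> y \<Longrightarrow> u \<bullet> w < u \<bullet> y"
    and "\<And>w. w \<in> S \<Longrightarrow> u \<bullet> w = u \<bullet> y \<Longrightarrow> v \<bullet> w < v \<bullet> y"
  shows "S \<inter> closed_quadrant u v y = {} \<or> S \<inter> closed_quadrant (- u) (- v) y = {}"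
proof (rule ccontr)
  assume "\<not> ?thesis"
  then have F: "frontier S \<inter> closed_quadrant u v y \<noteq> {}"
      "frontier S \<inter> closed_quadrant (- u) (- v) y \<noteq> {}"
    using compact_meets_closed_quadrant_imp_frontier[OF assms(1)] assms(3)
    by (auto simp: orthonormal_pair_uminus)
  have sub: "frontier S \<subseteq> S"
    using assms(1) by (simp add: compact_imp_closed frontier_subset_closed)
  have eq: "w \<in> open_quadrant u v y" if "w \<in> frontier S" "w \<in> closed_quadrant u v y" for w
    using that sub assms(4)[of w] assms(5)[of w]
    by (force simp: open_quadrant_def closed_quadrant_def)
  have "open_quadrant u v y \<inter> frontier S = {} \<or> - closed_quadrant u v y \<inter> frontier S = {}"
  proof (rule connectedD[OF assms(2) open_open_quadrant open_Compl[OF closed_closed_quadrant]])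
    show "open_quadrant u v y \<inter> - closed_quadrant u v y \<inter> frontier S = {}"
      by (auto simp: open_quadrant_def closed_quadrant_def)
    show "frontier S \<subseteq> open_quadrant u v y \<union> - closed_quadrant u v y"
      using eq by blast
  qed
  \<comment> \<open>The opposite closed quadrants share only \<open>y\<close>, which
    \<open>eq\<close> excludes from the frontier; so both separating sets meet it.\<close>
  then show False
    using F eq by (fastforce simp: open_quadrant_def closed_quadrant_def)
qed

text \<open>A compact set and a disjoint closed set have positive distance \<open>d\<close>, so the
  vertex can be moved back along the diagonal by less than \<open>d\<close>.\<close>

lemma enlarge_closed_quadrant:
  assumes "compact S" "orthonormal_pair u v" "S \<inter> closed_quadrant u v y = {}"
  shows "\<exists>z. y \<in> open_quadrant u v z \<and> open_quadrant u v z \<subseteq> - S"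
proof -
  have o: "u \<bullet> (u + v) = 1" "v \<bullet> (u + v) = 1"
    using orthonormal_pair_inner_inverse[OF assms(2), of 1 1] by auto
  then have nz: "u + v \<noteq> 0" by force
  obtain d where d: "d > 0" "\<And>a b. a \<in> S \<Longrightarrow> b \<in> closed_quadrant u v y \<Longrightarrow> d \<le> dist a b"
    using separate_compact_closed[OF assms(1) closed_closed_quadrant assms(3)] by blast
  define c where "c = d / (2 * norm (u + v))"
  have c: "c > 0" "c * norm (u + v) < d"
    using d(1) nz by (auto simp: c_def)
  have "y \<in> open_quadrant u v (y - c *\<^sub>R (u + v))"
    using c o by (simp add: open_quadrant_def inner_diff_right[of _ y])
  moreover have "w \<notin> S" if "w \<in> open_quadrant u v (y - c *\<^sub>R (u + v))" for w
  proof
    assume "w \<in> S"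
    \<comment> \<open>Undoing the shift brings \<open>w\<close> into the closed quadrant at a
      distance below \<open>d\<close>.\<close>
    moreover have "w + c *\<^sub>R (u + v) \<in> closed_quadrant u v y"
      using that o by (simp add: open_quadrant_def closed_quadrant_def
          inner_diff_right[of _ y] inner_add_right[of _ w])
    ultimately have "d \<le> dist w (w + c *\<^sub>R (u + v))" using d(2) by blast
    then show False using c by (simp add: dist_norm)
  qed
  ultimately show ?thesis by blast
qed

section \<open>The two implications for a fixed orthonormal pair\<close>

lemma biconvex_imp_quadrant:
  assumes "compact S" "connected (frontier S)" "orthonormal_pair u v" "biconvex u v S" "y \<notin> S"
  shows "\<exists>u'\<in>{u, - u}. \<exists>v'\<in>{v, - v}. \<exists>z. y \<in> open_quadrant u' v' z \<and> open_quadrant u' v' z \<subseteq> - S"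
proof -
  note B = assms(4)[unfolded biconvex_iff[OF assms(3)]]
  \<comment> \<open>Otherwise the line through \<open>y\<close> would carry points of
    \<open>S\<close> on both sides of \<open>y\<close>, forcing \<open>y\<close> into
    \<open>S\<close>. The sign of \<open>u'\<close> records the side that is free of
    \<open>S\<close>.\<close>
  have "(\<forall>w\<in>S. v \<bullet> w = v \<bullet> y \<longrightarrow> u \<bullet> w < u \<bullet> y) \<or>
      (\<forall>w\<in>S. v \<bullet> w = v \<bullet> y \<longrightarrow> u \<bullet> y < u \<bullet> w)"
    using B assms(5) by (meson not_less)
  then have "\<exists>u'\<in>{u, - u}. \<forall>w\<in>S. v \<bullet> w = v \<bullet> y \<longrightarrow> u' \<bullet> w < u' \<bullet> y"
    by simp
  then obtain u' where u': "u' \<in> {u, - u}" "\<forall>w\<in>S. v \<bullet> w = v \<bullet> y \<longrightarrow> u' \<bullet> w < u' \<bullet> y"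
    by blast
  have "(\<forall>w\<in>S. u \<bullet> w = u \<bullet> y \<longrightarrow> v \<bullet> w < v \<bullet> y) \<or>
      (\<forall>w\<in>S. u \<bullet> w = u \<bullet> y \<longrightarrow> v \<bullet> y < v \<bullet> w)"
    using B assms(5) by (meson not_less)
  then have "\<exists>v'\<in>{v, - v}. \<forall>w\<in>S. u \<bullet> w = u \<bullet> y \<longrightarrow> v' \<bullet> w < v' \<bullet> y"
    by simp
  then obtain v' where v': "v' \<in> {v, - v}" "\<forall>w\<in>S. u \<bullet> w = u \<bullet> y \<longrightarrow> v' \<bullet> w < v' \<bullet> y"
    by blast
  have o: "orthonormal_pair u' v'" "orthonormal_pair (- u') (- v')"
    using u' v' assms(3) by (auto simp: orthonormal_pair_uminus)
  have "S \<inter> closed_quadrant u' v' y = {} \<or> S \<inter> closed_quadrant (- u') (- v') y = {}"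
    using u' v' by (intro misses_quadrant_or_opposite assms o) auto
  then show ?thesis
  proof
    assume "S \<inter> closed_quadrant u' v' y = {}"
    from enlarge_closed_quadrant[OF assms(1) o(1) this] show ?thesis
      using u'(1) v'(1) by blast
  next
    assume "S \<inter> closed_quadrant (- u') (- v') y = {}"
    moreover have "- u' \<in> {u, - u}" "- v' \<in> {v, - v}"
      using u'(1) v'(1) by auto
    ultimately show ?thesis
      using enlarge_closed_quadrant[OF assms(1) o(2)] by blast
  qed
qed

text \<open>Let \<open>y\<close> lie between \<open>p\<close> and \<open>q\<close> on an
  axis-parallel line. A quadrant containing \<open>y\<close> is unbounded in one direction of that
  line, so it also contains the endpoint on that side.\<close>

lemma quadrant_imp_biconvex:
  assumes "orthonormal_pair u v"
    and "\<And>y. y \<notin> S \<Longrightarrow>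
      \<exists>u'\<in>{u, - u}. \<exists>v'\<in>{v, - v}. \<exists>z. y \<in> open_quadrant u' v' z \<and> open_quadrant u' v' z \<subseteq> - S"
  shows "biconvex u v S"
  unfolding biconvex_iff[OF assms(1)]
proof (intro conjI ballI allI impI; rule ccontr; elim conjE)
  fix p q y
  assume h: "p \<in> S" "q \<in> S" "y \<notin> S"
    "u \<bullet> p = u \<bullet> y" "u \<bullet> q = u \<bullet> y" "v \<bullet> p \<le> v \<bullet> y" "v \<bullet> y \<le> v \<bullet> q"
  obtain u' v' z where "u' \<in> {u, - u}" "v' \<in> {v, - v}" "y \<in> open_quadrant u' v' z"
      and *: "open_quadrant u' v' z \<subseteq> - S"
    using assms(2)[OF h(3)] by blast
  then have "p \<in> open_quadrant u' v' z \<or> q \<in> open_quadrant u' v' z"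
    using h by (auto simp: open_quadrant_def)
  then show False using * h by blast
next
  fix p q y
  assume h: "p \<in> S" "q \<in> S" "y \<notin> S"
    "v \<bullet> p = v \<bullet> y" "v \<bullet> q = v \<bullet> y" "u \<bullet> p \<le> u \<bullet> y" "u \<bullet> y \<le> u \<bullet> q"
  obtain u' v' z where "u' \<in> {u, - u}" "v' \<in> {v, - v}" "y \<in> open_quadrant u' v' z"
      and *: "open_quadrant u' v' z \<subseteq> - S"
    using assms(2)[OF h(3)] by blast
  then have "p \<in> open_quadrant u' v' z \<or> q \<in> open_quadrant u' v' z"
    using h by (auto simp: open_quadrant_def)
  then show False using * h by blast
qed

section \<open>Unit vectors as diagonals, and the equivalence\<close>

lemma norm_orthonormal_diagonal:
  assumes "orthonormal_pair u v"
  shows "norm ((u + v) /\<^sub>R sqrt 2) = 1"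
proof -
  have "(u + v) \<bullet> (u + v) = 2"
    using orthonormal_pair_inner_inverse[OF assms, of 1 1] by (simp add: inner_add_left)
  then have "norm (u + v) = sqrt 2"
    by (simp add: norm_eq_sqrt_inner)
  then show ?thesis by simp
qed

lemma unit_vector_as_diagonal:
  assumes "norm \<xi> = 1"
  obtains u v where "orthonormal_pair u v" "\<xi> = (u + v) /\<^sub>R sqrt 2"
proof -
  \<comment> \<open>This is \<open>\<xi>\<close> turned clockwise by \<open>pi / 4\<close>, itself
    the diagonal of the pair \<open>\<xi>\<close>, \<open>- rot90 \<xi>\<close>; its quarter turn
    supplies \<open>v\<close>.\<close>
  define u where "u = (\<xi> + - rot90 \<xi>) /\<^sub>R sqrt 2"
  have "norm u = 1"
    unfolding u_def using orthonormal_pair_rot90[OF assms]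
    by (intro norm_orthonormal_diagonal) (simp only: orthonormal_pair_uminus)
  moreover have "u + rot90 u = sqrt 2 *\<^sub>R \<xi>"
    by (simp only: u_def rot90_scaleR rot90_add rot90_minus rot90_rot90)
      (simp add: real_div_sqrt divide_inverse[symmetric] algebra_simps flip: scaleR_2)
  then have "\<xi> = (u + rot90 u) /\<^sub>R sqrt 2"
    by simp
  ultimately show ?thesis
    using that orthonormal_pair_rot90 by blast
qed

theorem theorem2:
  fixes S :: "(real^2) set"
  assumes "compact S"
    and "path_connected (frontier S)"
    and "S = closure (interior S)"
  shows "(\<exists>b1 b2. orthonormal_pair b1 b2 \<and> biconvex b1 b2 S) \<longleftrightarrow>
         (\<exists>\<xi>. norm \<xi> = 1 \<and>
            (\<forall>y \<in> - S. \<exists>i \<in> {0, 1, 2, 3}. \<exists>z.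
               y \<in> right_cone ((rot90 ^^ i) \<xi>) z \<and>
               right_cone ((rot90 ^^ i) \<xi>) z \<subseteq> - S))"
    (is "?L \<longleftrightarrow> ?R")
proof
  assume ?L
  then obtain u v where o: "orthonormal_pair u v" and "biconvex u v S" by blast
  then have "\<exists>u'\<in>{u, - u}. \<exists>v'\<in>{v, - v}. \<exists>z.
      y \<in> open_quadrant u' v' z \<and> open_quadrant u' v' z \<subseteq> - S" if "y \<in> - S" for y
    using biconvex_imp_quadrant assms(1) path_connected_imp_connected[OF assms(2)] that by blast
  then show ?R
    \<comment> \<open>The witness for \<open>\<xi>\<close> is the diagonal of \<open>u, v\<close>;
      \<open>P\<close> says that some translate contains \<open>y\<close> and avoids
      \<open>S\<close>.\<close>
    using norm_orthonormal_diagonal[OF o]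
      ex_cone_iff_ex_quadrant[OF o, of "\<lambda>C. \<exists>z. y \<in> C z \<and> C z \<subseteq> - S" for y]
    by blast
next
  assume ?R
  then obtain \<xi> where "norm \<xi> = 1" and C: "\<forall>y \<in> - S. \<exists>i \<in> {0, 1, 2, 3}. \<exists>z.
      y \<in> right_cone ((rot90 ^^ i) \<xi>) z \<and> right_cone ((rot90 ^^ i) \<xi>) z \<subseteq> - S"
    by blast
  then obtain u v where o: "orthonormal_pair u v" and \<xi>: "\<xi> = (u + v) /\<^sub>R sqrt 2"
    using unit_vector_as_diagonal by blast
  have "biconvex u v S"
    using C unfolding \<xi>
      ex_cone_iff_ex_quadrant[OF o, of "\<lambda>C. \<exists>z. y \<in> C z \<and> C z \<subseteq> - S" for y]
    by (intro quadrant_imp_biconvex[OF o]) blast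
  with o show ?L by blast
qed

end
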